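(* Let $f:(0,\infty)\to\mathbb{R}$ be a measurable function and let $L\in\mathbb{R}$. Suppose that $$\lim_{n\to\infty} f(an)=L\quad\text{for almost every } a>0,$$ where $n$ ranges over the positive integers. Then for all $\varepsilon>0$ and all $C>1$, $$\lim_{x\to\infty}\frac{\mu\left(\{t\in[x,Cx]: |f(t)-L|>\varepsilon\}\right)}{\mu([x,Cx])}=0 .$$
   Context: $\mu$ denotes Lebesgue measure on $\mathbb{R}$; "measurable" and "almost every" refer to Lebesgue measure. In the conclusion $x$ is a continuous real variable tending to $\infty$. *)

theory Defs
  imports "HOL-Analysis.Analysis"
begin

end

theory Submission imports Defs begin

text \<open>If \<open>t\<close> is an exceptional point in \<open>[x, Cx]\<close> and \<open>n = \<lfloor>x\<rfloor>\<close>, then \<open>t / n\<close> lies in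
  \<open>[1, 2C]\<close> and the sequence \<open>f (a m)\<close> with \<open>a = t / n\<close> still deviates from \<open>L\<close> at \<open>m = n\<close>.
  So the exceptional part of \<open>[x, Cx]\<close> is contained in the \<open>n\<close>-fold dilate of the set of those
  \<open>a \<in> [1, 2C]\<close> with a deviation at some index \<open>m \<ge> n\<close>. The measure of the latter set tends to \<open>0\<close>,
  by almost everywhere convergence and continuity from above.\<close>

lemma dilation_vimage_lebesgue:
  fixes E :: "real set"
  assumes "E \<in> sets lebesgue"
  shows "{a. a * c \<in> E} \<in> sets lebesgue"
proof -
  have "(\<lambda>a::real. c *\<^sub>R a) -` E \<inter> space lebesgue \<in> sets lebesgue"
    using lebesgue_measurable_scaling assms by (rule measurable_sets)
  then show ?thesis
    by (simp add: vimage_def mult.commute)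
qed

text \<open>An affine map is differentiable, hence preserves Lebesgue measurability, and it scales
  measure by the finite factor \<open>\<bar>c\<bar> ^ DIM('a)\<close>.\<close>

lemma lmeasurable_affine_image:
  fixes S :: "'a::euclidean_space set"
  assumes "S \<in> lmeasurable"
  shows "(\<lambda>x. c *\<^sub>R x + b) ` S \<in> lmeasurable"
proof (rule fmeasurableI)
  show "(\<lambda>x. c *\<^sub>R x + b) ` S \<in> sets lebesgue"
    using assms by (intro differentiable_image_in_sets_lebesgue derivative_intros) auto
  have "emeasure lebesgue S < \<infinity>"
    using fmeasurableD2[OF assms] unfolding infinity_ennreal_def less_top .
  then show "emeasure lebesgue ((\<lambda>x. c *\<^sub>R x + b) ` S) < \<infinity>"
    unfolding emeasure_lebesgue_affine infinity_ennreal_def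
    by (simp add: ennreal_mult_less_top del: emeasure_completion)
qed

text \<open>The sets decrease in \<open>N\<close>, and each is \<open>K\<close> cut with a countable
  union of preimages of \<open>E\<close> under dilations. Since \<open>K\<close> has finite measure,
  continuity from above applies.\<close>

lemma tendsto_measure_late_hits:
  fixes E K :: "real set"
  assumes E: "E \<in> sets lebesgue" and K: "K \<in> lmeasurable"
    and ae: "AE a in lebesgue. a \<in> K \<longrightarrow> (\<forall>\<^sub>F n in sequentially. a * real n \<notin> E)"
  shows "(\<lambda>N. measure lebesgue {a \<in> K. \<exists>n\<ge>N. a * real n \<in> E}) \<longlonglongrightarrow> 0"
    and "{a \<in> K. \<exists>n\<ge>N. a * real n \<in> E} \<in> lmeasurable"
proof -
  define D where "D N = {a \<in> K. \<exists>n\<ge>N. a * real n \<in> E}" for N :: nat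
  have D: "D N \<in> lmeasurable" for N
  proof -
    have "D N = K \<inter> (\<Union>n\<in>{N..}. {a. a * real n \<in> E})"
      by (auto simp: D_def)
    moreover have "(\<Union>n\<in>{N..}. {a. a * real n \<in> E}) \<in> sets lebesgue"
      using dilation_vimage_lebesgue[OF E] by auto
    ultimately show ?thesis
      using K by (simp add: fmeasurable_Int_fmeasurable)
  qed
  have "(\<lambda>N. measure lebesgue (D N)) \<longlonglongrightarrow> measure lebesgue (\<Inter>N. D N)"
  proof (rule Lim_measure_decseq)
    show "range D \<subseteq> sets lebesgue"
      using D by auto
    show "decseq D"
      unfolding decseq_def D_def by (auto intro: order_trans)
    show "emeasure lebesgue (D N) \<noteq> \<infinity>" for N
      unfolding infinity_ennreal_def using D by (rule fmeasurableD2)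
  qed
  \<comment> \<open>A point in every \<open>D N\<close> lies in \<open>K\<close> and has multiples
    \<open>a * real n\<close> in \<open>E\<close> for arbitrarily large \<open>n\<close>, which
    \<open>ae\<close> excludes almost everywhere.\<close>
  moreover have "AE a in lebesgue. a \<notin> (\<Inter>N. D N)"
    using ae unfolding D_def eventually_sequentially by eventually_elim blast
  then have "(\<Inter>N. D N) \<in> null_sets lebesgue"
    using D by (subst AE_iff_null_sets) auto
  then have "measure lebesgue (\<Inter>N. D N) = 0"
    by (simp add: measure_eq_0_null_sets)
  ultimately show "(\<lambda>N. measure lebesgue {a \<in> K. \<exists>n\<ge>N. a * real n \<in> E}) \<longlonglongrightarrow> 0"
    unfolding D_def[symmetric] by (simp only:)
  show "{a \<in> K. \<exists>n\<ge>N. a * real n \<in> E} \<in> lmeasurable"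
    using D unfolding D_def .
qed

text \<open>Dilation by \<open>n\<close> multiplies measure by \<open>n \<le> x\<close>, while
  \<open>{x..C * x}\<close> has length \<open>(C - 1) * x\<close>. The factor \<open>x\<close>
  cancels, so a bound on late hits in a fixed window suffices.\<close>

lemma tendsto_relative_measure_0:
  fixes E :: "real set"
  assumes E: "E \<in> sets lebesgue" and C: "C > 1"
    and ae: "AE a in lebesgue. a > 0 \<longrightarrow> (\<forall>\<^sub>F n in sequentially. a * real n \<notin> E)"
  shows "((\<lambda>x. measure lebesgue ({x..C * x} \<inter> E) / measure lebesgue {x..C * x}) \<longlongrightarrow> 0) at_top"
proof (rule tendstoI)
  fix e :: real assume "e > 0"
  define D where "D N = {a \<in> {1..2 * C}. \<exists>n\<ge>N. a * real n \<in> E}" for N :: nat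
  have ae': "AE a in lebesgue. a \<in> {1..2 * C} \<longrightarrow> (\<forall>\<^sub>F n in sequentially. a * real n \<notin> E)"
    using ae by eventually_elim auto
  note D = tendsto_measure_late_hits[OF E _ ae', folded D_def, simplified]
  \<comment> \<open>The factor \<open>C - 1\<close> is the length of \<open>{x..C * x}\<close>
    divided by \<open>x\<close>.\<close>
  have "\<forall>\<^sub>F N in sequentially. measure lebesgue (D N) < e * (C - 1)"
    using D(1) \<open>e > 0\<close> C by (intro order_tendstoD) auto
  then obtain N where N: "measure lebesgue (D N) < e * (C - 1)"
    by (auto simp: eventually_sequentially)
  \<comment> \<open>The \<open>+ 1\<close> ensures that the floor of \<open>x\<close> is positive
    even when \<open>N = 0\<close>, so that division by it makes sense.\<close>
  have "dist (measure lebesgue ({x..C * x} \<inter> E) / measure lebesgue {x..C * x}) 0 < e"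
    if x: "x \<ge> real N + 1" for x
  proof -
    define n where "n = nat \<lfloor>x\<rfloor>"
    have n: "real n \<le> x" "x < real n + 1"
      using x by (auto simp: n_def)
    then have n': "n \<ge> N" "n \<ge> 1"
      using x by linarith+
    \<comment> \<open>From \<open>n \<ge> 1\<close> follows \<open>x < n + 1 \<le> 2 * n\<close>;
      this is the source of the upper end \<open>2 * C\<close> of the window, which does not depend
      on \<open>x\<close>.\<close>
    have Cx: "C * x \<le> C * (2 * real n)"
      using C n n' by (intro mult_left_mono) auto
    have sub: "{x..C * x} \<inter> E \<subseteq> (\<lambda>a. real n *\<^sub>R a + 0) ` D N"
    proof
      fix t assume t: "t \<in> {x..C * x} \<inter> E"
      have "real n \<le> t" "t \<le> (2 * C) * real n"
        using t n Cx by auto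
      then have "t / real n \<in> {1..2 * C}"
        using n' by (simp add: pos_le_divide_eq pos_divide_le_eq)
      moreover have "t / real n * real n \<in> E"
        using t n' by simp
      ultimately have "t / real n \<in> D N"
        using n' unfolding D_def by blast
      then show "t \<in> (\<lambda>a. real n *\<^sub>R a + 0) ` D N"
        using n' by (intro image_eqI[of _ _ "t / real n"]) auto
    qed
    have "(\<lambda>a. real n *\<^sub>R a + 0) ` D N \<in> lmeasurable"
      using D(2) by (rule lmeasurable_affine_image)
    then have "measure lebesgue ({x..C * x} \<inter> E) \<le> measure lebesgue ((\<lambda>a. real n *\<^sub>R a + 0) ` D N)"
      using sub E by (intro measure_mono_fmeasurable) auto
    also have "\<dots> = real n * measure lebesgue (D N)"
      by (subst measure_lebesgue_affine) auto
    also have "\<dots> \<le> x * measure lebesgue (D N)"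
      using n by (intro mult_right_mono) auto
    also have "\<dots> < x * (e * (C - 1))"
      using x N by (intro mult_strict_left_mono) auto
    finally have "measure lebesgue ({x..C * x} \<inter> E) < e * (C * x - x)"
      by (simp add: algebra_simps)
    moreover have "C * x > x"
      using C x by simp
    ultimately show ?thesis
      using C by (simp add: pos_divide_less_eq)
  qed
  then show "\<forall>\<^sub>F x in at_top.
      dist (measure lebesgue ({x..C * x} \<inter> E) / measure lebesgue {x..C * x}) 0 < e"
    by (rule eventually_at_top_linorderI)
qed

theorem proposition4p4:
  fixes f :: "real \<Rightarrow> real" and L :: real
  assumes "f \<in> borel_measurable (lebesgue_on {0<..})"
    and "AE a in lebesgue. a > 0 \<longrightarrow> (\<lambda>n::nat. f (a * real n)) \<longlonglongrightarrow> L"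
  shows "\<forall>\<epsilon>>0. \<forall>C>1.
    ((\<lambda>x::real. measure lebesgue {t \<in> {x..C * x}. \<bar>f t - L\<bar> > \<epsilon>}
                 / measure lebesgue {x..C * x}) \<longlongrightarrow> 0) at_top"
proof (intro allI impI)
  fix \<epsilon> C :: real assume \<epsilon>: "\<epsilon> > 0" and C: "C > 1"
  \<comment> \<open>The hypothesis on \<open>f\<close> gives measurability only on the positive
    half-line, so the exceptional set is confined to it.\<close>
  define E where "E = {t \<in> {0<..}. \<bar>f t - L\<bar> > \<epsilon>}"
  have "{t \<in> space (lebesgue_on {0<..}). \<bar>f t - L\<bar> > \<epsilon>} \<in> sets (lebesgue_on {0<..})"
    using assms(1) by measurable
  then have E: "E \<in> sets lebesgue"
    by (auto simp: E_def sets_restrict_space_iff)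
  have "AE a in lebesgue. a > 0 \<longrightarrow> (\<forall>\<^sub>F n in sequentially. a * real n \<notin> E)"
    using assms(2)
  proof eventually_elim
    case (elim a)
    show ?case
    proof
      assume "a > 0"
      then have "\<forall>\<^sub>F n in sequentially. dist (f (a * real n)) L < \<epsilon>"
        using elim \<epsilon> by (auto dest: tendstoD)
      then show "\<forall>\<^sub>F n in sequentially. a * real n \<notin> E"
        by eventually_elim (simp add: E_def dist_real_def)
    qed
  qed
  note lim = tendsto_relative_measure_0[OF E C this]
  \<comment> \<open>Once \<open>x > 0\<close>, the whole interval is positive and the confinement of
    \<open>E\<close> loses nothing.\<close>
  have "\<forall>\<^sub>F x in at_top. {x..C * x} \<inter> E = {t \<in> {x..C * x}. \<bar>f t - L\<bar> > \<epsilon>}"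
    using eventually_gt_at_top[of 0] by eventually_elim (auto simp: E_def)
  then show "((\<lambda>x. measure lebesgue {t \<in> {x..C * x}. \<bar>f t - L\<bar> > \<epsilon>}
      / measure lebesgue {x..C * x}) \<longlongrightarrow> 0) at_top"
    by (intro Lim_transform_eventually[OF lim]) (elim eventually_mono, simp only:)
qed

end
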